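(* Let $ABC$ be a triangle. Draw lines $l_A, l_B, l_C$ through the vertices $A, B, C$ respectively, and let $l'_A, l'_B, l'_C$ be the lines symmetric to $l_A, l_B, l_C$ with respect to the bisectors of the angles $A, B, C$ of the triangle, respectively. Let $X$ be the intersection point of $l_B$ and $l'_C$, let $Y$ be the intersection point of $l_C$ and $l'_A$, and let $Z$ be the intersection point of $l_A$ and $l'_B$. Then the lines $AX$, $BY$ and $CZ$ intersect at a point.
   Context: The setting is the Euclidean plane. All objects are defined in the claim.
   Formalization: The lines AX, BY, CZ can be distinct and parallel, so the conclusion proved is that they intersect at a point or are all parallel; X, Y, Z are assumed to be unique intersection points with X≠A, Y≠B, Z≠C so that the lines AX, BY, CZ exist. *)

theory Defs
  imports "HOL-Analysis.Analysis"
begin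

definition is_line :: "(real ^ 2) set \<Rightarrow> bool" where
  "is_line l \<longleftrightarrow> (\<exists>P Q. P \<noteq> Q \<and> l = affine hull {P, Q})"

text \<open>Unsigned angle between two vectors, in \<open>[0, \<pi>]\<close>. Because of \<open>x / 0 = 0\<close> it takes the
  value \<open>\<pi>/2\<close> if one of the vectors is zero.\<close>

definition vec_angle :: "real ^ 2 \<Rightarrow> real ^ 2 \<Rightarrow> real" where
  "vec_angle u v = arccos ((u \<bullet> v) / (norm u * norm v))"

text \<open>The (internal) bisector, as a full line, of the angle at the vertex \<open>A\<close> of a
  nondegenerate triangle \<open>ABC\<close>. The points \<open>P\<close> of the triangle with equal angles
  \<open>BAP\<close> and \<open>PAC\<close> form the bisector segment from \<open>A\<close> to the side \<open>BC\<close> (the vertex \<open>A\<close> itself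
  satisfies the condition by the convention for the zero vector); the bisector is
  the line spanned by this segment.\<close>

definition angle_bisector :: "real ^ 2 \<Rightarrow> real ^ 2 \<Rightarrow> real ^ 2 \<Rightarrow> (real ^ 2) set" where
  "angle_bisector B A C =
     affine hull {P \<in> convex hull {A, B, C}. vec_angle (B - A) (P - A) = vec_angle (P - A) (C - A)}"

text \<open>Reflection in a line \<open>m\<close>: the foot \<open>closest_point m P\<close> of the perpendicular from \<open>P\<close> to \<open>m\<close> is
  the midpoint of \<open>P\<close> and its image.\<close>

definition reflect_in :: "(real ^ 2) set \<Rightarrow> real ^ 2 \<Rightarrow> real ^ 2" where
  "reflect_in m P = 2 *\<^sub>R closest_point m P - P"

end

theory Submission
  imports Defs
begin

text \<open>Let \<open>x, y, z\<close> be the signed distances to \<open>BC, CA, AB\<close>. Reflection in the bisector at \<open>A\<close>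
  interchanges \<open>y\<close> and \<open>z\<close>, so \<open>l\<^sub>A\<close> and \<open>l'\<^sub>A\<close> have equations \<open>u\<^sub>1 y + u\<^sub>2 z = 0\<close> and
  \<open>u\<^sub>2 y + u\<^sub>1 z = 0\<close>; similarly at \<open>B\<close> with \<open>v\<^sub>1 z + v\<^sub>2 x\<close> and at \<open>C\<close> with \<open>w\<^sub>1 x + w\<^sub>2 y\<close>. Eliminating
  \<open>x\<close> at \<open>X\<close> shows that \<open>AX\<close> is the line \<open>v\<^sub>2 w\<^sub>1 y = v\<^sub>1 w\<^sub>2 z\<close>. It and its two cyclic analogues pass
  through the projective point with trilinear coordinates
  \<open>(u\<^sub>1 v\<^sub>2 w\<^sub>2 : u\<^sub>2 v\<^sub>1 w\<^sub>2 : u\<^sub>2 v\<^sub>2 w\<^sub>1)\<close>; if that point is at infinity, the three lines are parallel.\<close>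

section \<open>Cross products and signed distances in the plane\<close>

definition cross2 :: "real ^ 2 \<Rightarrow> real ^ 2 \<Rightarrow> real" where
  "cross2 u v = u $ 1 * v $ 2 - u $ 2 * v $ 1"

text \<open>Normalising the direction by \<open>sgn\<close> gives the signed distance to the line
  from \<open>U\<close> to \<open>V\<close>, positive on its left. Along \<open>BC\<close>,
  \<open>CA\<close>, \<open>AB\<close> the three distances have equal signs inside the
  triangle.\<close>

definition sdist :: "real ^ 2 \<Rightarrow> real ^ 2 \<Rightarrow> real ^ 2 \<Rightarrow> real" where
  "sdist U V P = cross2 (sgn (V - U)) (P - U)"

lemma inner_real2: "(u :: real ^ 2) \<bullet> v = u $ 1 * v $ 1 + u $ 2 * v $ 2"
  by (simp add: inner_vec_def sum_2)

lemma cross2_self [simp]: "cross2 u u = 0"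
  by (simp add: cross2_def)

lemma cross2_zero [simp]: "cross2 0 u = 0" "cross2 u 0 = 0"
  by (simp_all add: cross2_def)

lemma cross2_commute: "cross2 u v = - cross2 v u"
  by (simp add: cross2_def)

lemma cross2_add: "cross2 (u + v) w = cross2 u w + cross2 v w" "cross2 w (u + v) = cross2 w u + cross2 w v"
  by (simp_all add: cross2_def algebra_simps)

lemma cross2_diff: "cross2 (u - v) w = cross2 u w - cross2 v w" "cross2 w (u - v) = cross2 w u - cross2 w v"
  by (simp_all add: cross2_def algebra_simps)

lemma cross2_minus: "cross2 (- u) w = - cross2 u w" "cross2 w (- u) = - cross2 w u"
  by (simp_all add: cross2_def algebra_simps)

lemma cross2_scaleR: "cross2 (t *\<^sub>R u) w = t * cross2 u w" "cross2 w (t *\<^sub>R u) = t * cross2 w u"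
  by (simp_all add: cross2_def algebra_simps)

lemmas cross2_linear = cross2_add cross2_diff cross2_minus cross2_scaleR

lemma cross2_eq_0E:
  assumes "cross2 q r = 0" "q \<noteq> 0"
  obtains t where "r = t *\<^sub>R q"
proof
  \<comment> \<open>The difference of the two sides is \<open>cross2 q r\<close> times
    \<open>q\<close> rotated by a right angle.\<close>
  have "(q \<bullet> q) *\<^sub>R r = (q \<bullet> r) *\<^sub>R q"
    using assms(1) unfolding vec_eq_iff forall_2 inner_real2 cross2_def
    by simp algebra
  then have "(1 / (q \<bullet> q)) *\<^sub>R ((q \<bullet> q) *\<^sub>R r) = (1 / (q \<bullet> q)) *\<^sub>R ((q \<bullet> r) *\<^sub>R q)"
    by simp
  then show "r = ((q \<bullet> r) / (q \<bullet> q)) *\<^sub>R q"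
    using assms(2) by simp
qed

text \<open>The vectors orthogonal to a nonzero vector of the plane form a one-dimensional
  space.\<close>

lemma cross2_perp:
  assumes "d \<noteq> 0" "u \<bullet> d = 0" "v \<bullet> d = 0"
  shows "cross2 u v = 0"
proof -
  have "d $ 1 * cross2 u v = 0" "d $ 2 * cross2 u v = 0"
    using assms(2,3) unfolding inner_real2 cross2_def by algebra+
  moreover have "d $ 1 \<noteq> 0 \<or> d $ 2 \<noteq> 0"
    using assms(1) by (auto simp: vec_eq_iff forall_2)
  ultimately show ?thesis by auto
qed

lemma collinear_iff_cross2: "collinear {A, B, C} \<longleftrightarrow> cross2 (B - A) (C - A) = 0"
proof -
  have "collinear {A, B, C} \<longleftrightarrow> collinear {0, B - A, C - A}"
    using collinear_3[of B A C] by (simp add: insert_commute)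
  also have "\<dots> \<longleftrightarrow> cross2 (B - A) (C - A) = 0"
    unfolding collinear_lemma by (auto simp: cross2_scaleR elim: cross2_eq_0E)
  finally show ?thesis .
qed

lemma in_affine_hull_iff_cross2:
  assumes "X \<noteq> A"
  shows "Q \<in> affine hull {A, X} \<longleftrightarrow> cross2 (X - A) (Q - A) = 0"
proof
  assume "Q \<in> affine hull {A, X}"
  then obtain s t where "s + t = 1" "Q = s *\<^sub>R A + t *\<^sub>R X"
    unfolding affine_hull_2 by auto
  then have "Q = (1 - t) *\<^sub>R A + t *\<^sub>R X"
    by (metis add_diff_cancel_right')
  then have "Q - A = t *\<^sub>R (X - A)"
    by (simp add: algebra_simps)
  then show "cross2 (X - A) (Q - A) = 0"
    by (simp add: cross2_scaleR)
next
  assume "cross2 (X - A) (Q - A) = 0"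
  then obtain t where "Q - A = t *\<^sub>R (X - A)"
    using assms by (auto elim: cross2_eq_0E)
  then have "Q = (1 - t) *\<^sub>R A + t *\<^sub>R X"
    by (simp add: algebra_simps)
  then show "Q \<in> affine hull {A, X}"
    unfolding affine_hull_2 by force
qed

lemma sdist_combination:
  assumes "r + s + t = 1"
  shows "sdist U V (r *\<^sub>R P + s *\<^sub>R Q + t *\<^sub>R R) = r * sdist U V P + s * sdist U V Q + t * sdist U V R"
proof -
  have "r *\<^sub>R P + s *\<^sub>R Q + t *\<^sub>R R - U =
      r *\<^sub>R (P - U) + s *\<^sub>R (Q - U) + t *\<^sub>R (R - U) - (1 - (r + s + t)) *\<^sub>R U"
    by (simp add: algebra_simps)
  then show ?thesis
    using assms by (simp add: sdist_def cross2_linear)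
qed

lemma sdist_endpoints [simp]: "sdist U V U = 0" "sdist U V V = 0"
  by (simp_all add: sdist_def sgn_div_norm cross2_scaleR)

lemma sdist_translate: "sdist U V (P + w) = sdist U V P + cross2 (sgn (V - U)) w"
  by (simp add: sdist_def cross2_linear)

text \<open>With base point \<open>A\<close> instead of \<open>C\<close>, both sides at
  \<open>A\<close> are described by cross products with \<open>P - A\<close>; reversing the
  direction produces the sign.\<close>

lemma sdist_other_end: "sdist C A P = - cross2 (sgn (C - A)) (P - A)"
proof -
  have "sdist C A P = sdist C A A + cross2 (sgn (A - C)) (P - A)"
    using sdist_translate[of C A A "P - A"] by simp
  also have "sgn (A - C) = - sgn (C - A)"
    using sgn_minus[of "C - A"] by simp
  finally show ?thesis by (simp add: cross2_minus)
qed

text \<open>Both sides are twice the signed area of \<open>UVP\<close>; this clears the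
  normalisation in \<open>sdist\<close>.\<close>

lemma norm_sdist: "norm (V - U) * sdist U V P = cross2 (V - U) (P - U)"
  by (cases "V = U") (simp_all add: sdist_def sgn_div_norm cross2_scaleR)

text \<open>The distances to \<open>CA\<close> and \<open>AB\<close> are linear in
  \<open>P - A\<close>, and a linear map of the plane multiplies cross products by its determinant.
  For a nondegenerate triangle this is the sine of the angle at \<open>A\<close>, up to
  orientation.\<close>

lemma sdist_det:
  "cross2 (P - A) (Q - A) * cross2 (B - A) (C - A) =
    norm (A - C) * norm (B - A) * (sdist C A P * sdist A B Q - sdist A B P * sdist C A Q)"
proof -
  have "norm (A - C) * norm (B - A) * (sdist C A P * sdist A B Q - sdist A B P * sdist C A Q) =
     cross2 (A - C) (P - C) * cross2 (B - A) (Q - A) - cross2 (B - A) (P - A) * cross2 (A - C) (Q - C)"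
    unfolding norm_sdist[symmetric] by (simp add: algebra_simps)
  then show ?thesis
    by (simp add: cross2_def algebra_simps)
qed

text \<open>Both points solve the same nontrivial homogeneous equation, so the determinant in
  \<open>sdist_det\<close> vanishes.\<close>

lemma sdist_line:
  assumes "\<not> collinear {A, B, C}" "X \<noteq> A" "\<alpha> \<noteq> 0 \<or> \<beta> \<noteq> 0"
    and "\<alpha> * sdist C A X + \<beta> * sdist A B X = 0"
    and "\<alpha> * sdist C A Q + \<beta> * sdist A B Q = 0"
  shows "Q \<in> affine hull {A, X}"
proof -
  have "\<alpha> * (sdist C A X * sdist A B Q - sdist A B X * sdist C A Q) = 0"
    "\<beta> * (sdist C A X * sdist A B Q - sdist A B X * sdist C A Q) = 0"
    using assms(4,5) by algebra+
  then have "sdist C A X * sdist A B Q - sdist A B X * sdist C A Q = 0"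
    using assms(3) by auto
  then have "cross2 (X - A) (Q - A) * cross2 (B - A) (C - A) = 0"
    unfolding sdist_det by simp
  then show ?thesis
    using assms(1,2) by (simp add: collinear_iff_cross2 in_affine_hull_iff_cross2)
qed

section \<open>Internal bisectors and reflection in them\<close>

lemma sgn_diff_nonzero:
  assumes "\<not> collinear {A, B, C}"
  shows "sgn (B - A) - sgn (C - A) \<noteq> (0 :: real ^ 2)"
proof
  assume "sgn (B - A) - sgn (C - A) = 0"
  then have "cross2 (sgn (B - A)) (sgn (C - A)) = 0" by simp
  then have "B = A \<or> C = A \<or> cross2 (B - A) (C - A) = 0"
    by (auto simp: sgn_div_norm cross2_scaleR)
  with assms show False by (auto simp: collinear_iff_cross2)
qed

text \<open>Cauchy-Schwarz places both quotients in [-1, 1], where \<open>arccos\<close> is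
  injective; equal angles therefore have equal cosines, and \<open>norm w\<close> cancels.\<close>

lemma vec_angle_eq_imp:
  assumes "vec_angle u w = vec_angle w v"
  shows "w \<bullet> (sgn u - sgn v) = 0"
proof (cases "w = 0")
  case False
  have bound: "\<bar>(x \<bullet> y) / (norm x * norm y)\<bar> \<le> 1" for x y :: "real ^ 2"
  proof -
    have "0 \<le> norm x * norm y" by simp
    with Cauchy_Schwarz_ineq2[of x y] show ?thesis
      unfolding abs_divide abs_of_nonneg[OF \<open>0 \<le> norm x * norm y\<close>] divide_le_eq_1 by argo
  qed
  have "(u \<bullet> w) / (norm u * norm w) = (w \<bullet> v) / (norm w * norm v)"
    using assms arccos_eq_iff bound unfolding vec_angle_def by metis
  then have "((u \<bullet> w) / norm u) / norm w = ((w \<bullet> v) / norm v) / norm w"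
    by (simp add: field_simps)
  then have "(u \<bullet> w) / norm u = (w \<bullet> v) / norm v"
    using False by (simp only: divide_cancel_right norm_eq_zero simp_thms)
  then show ?thesis
    by (simp add: sgn_div_norm inner_diff_right inner_commute divide_inverse mult.commute)
qed simp

text \<open>The difference of the unit vectors along the sides is a normal of the internal bisector.
  One inclusion holds because the hull is minimal; for the other, two points of the bisector segment
  already span the line.\<close>

lemma angle_bisector_eq:
  assumes "\<not> collinear {A, B, C}"
  shows "angle_bisector B A C = {P. (P - A) \<bullet> (sgn (B - A) - sgn (C - A)) = 0}"
proof
  let ?d = "sgn (B - A) - sgn (C - A)"
  let ?S = "{P \<in> convex hull {A, B, C}. vec_angle (B - A) (P - A) = vec_angle (P - A) (C - A)}"
  have "{P. (P - A) \<bullet> ?d = 0} = {P. ?d \<bullet> P = ?d \<bullet> A}"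
    by (auto simp: inner_diff_left inner_diff_right inner_commute)
  then have "affine {P. (P - A) \<bullet> ?d = 0}"
    by (simp add: affine_hyperplane)
  then show "angle_bisector B A C \<subseteq> {P. (P - A) \<bullet> ?d = 0}"
    unfolding angle_bisector_def by (intro hull_minimal) (auto dest: vec_angle_eq_imp)
  let ?b = "norm (B - A)" and ?c = "norm (C - A)"
  have ne: "B \<noteq> A" "C \<noteq> A" and cr: "cross2 (B - A) (C - A) \<noteq> 0"
    using assms by (auto simp: collinear_iff_cross2)
  then have pos: "?b > 0" "?c > 0" by auto
  \<comment> \<open>\<open>F\<close> is the foot of the bisector on \<open>BC\<close>, dividing that
    side in the ratio \<open>AB : AC\<close>.\<close>
  define F where "F = A + (?b * ?c / (?b + ?c)) *\<^sub>R (sgn (B - A) + sgn (C - A))"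
  have "?b + ?c > 0" using pos by (rule add_pos_pos)
  then have sum1: "?c / (?b + ?c) + ?b / (?b + ?c) = 1"
    by (metis add.commute add_divide_distrib divide_self less_irrefl)
  have FA: "F - A = (?c / (?b + ?c)) *\<^sub>R (B - A) + (?b / (?b + ?c)) *\<^sub>R (C - A)"
  proof -
    have "x * y / (x + y) * inverse x = y / (x + y)" "x * y / (x + y) * inverse y = x / (x + y)"
      if "x > 0" "y > 0" for x y :: real
      using that by (simp_all add: field_simps)
    from this[OF pos] show ?thesis
      by (simp only: F_def sgn_div_norm scaleR_add_right scaleR_scaleR add_diff_cancel_left')
  qed
  have "F = (1 - (?c / (?b + ?c) + ?b / (?b + ?c))) *\<^sub>R A
      + (?c / (?b + ?c)) *\<^sub>R B + (?b / (?b + ?c)) *\<^sub>R C"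
    using FA by (simp add: algebra_simps)
  then have "F = 0 *\<^sub>R A + (?c / (?b + ?c)) *\<^sub>R B + (?b / (?b + ?c)) *\<^sub>R C"
    using sum1 by simp
  then have hull: "F \<in> convex hull {A, B, C}"
    unfolding convex_hull_3 using sum1 pos
    by (intro CollectI exI[of _ 0] exI[of _ "?c / (?b + ?c)"] exI[of _ "?b / (?b + ?c)"]) auto
  have "cross2 (F - A) (C - A) \<noteq> 0"
    unfolding FA cross2_add cross2_scaleR using cr pos(2) \<open>?b + ?c > 0\<close> by simp
  then have "F \<noteq> A" by auto
  have unit: "sgn (B - A) \<bullet> sgn (B - A) = 1" "sgn (C - A) \<bullet> sgn (C - A) = 1"
    using ne by (simp_all add: dot_square_norm norm_sgn)
  \<comment> \<open>The sum and the difference of two unit vectors are orthogonal.\<close>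
  have perp: "(F - A) \<bullet> ?d = 0"
    using unit by (simp add: F_def inner_add_left inner_add_right inner_diff_left inner_diff_right inner_commute)
  then have "((B - A) \<bullet> (F - A)) / ?b = ((F - A) \<bullet> (C - A)) / ?c"
    by (simp add: sgn_div_norm inner_diff_right inner_commute divide_inverse mult.commute)
  then have "((B - A) \<bullet> (F - A)) / (?b * norm (F - A)) = ((F - A) \<bullet> (C - A)) / (norm (F - A) * ?c)"
    by (simp only: mult.commute[of "norm (F - A)"] divide_divide_eq_left[symmetric])
  then have "F \<in> ?S" using hull by (simp add: vec_angle_def)
  \<comment> \<open>At the vertex both quotients are 0 / 0, so both angles take the same default
    value.\<close>
  moreover have "A \<in> ?S" by (simp add: vec_angle_def hull_inc)
  ultimately have sub: "affine hull {A, F} \<subseteq> angle_bisector B A C"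
    unfolding angle_bisector_def by (intro hull_mono) auto
  show "{P. (P - A) \<bullet> ?d = 0} \<subseteq> angle_bisector B A C"
  proof
    fix P assume "P \<in> {P. (P - A) \<bullet> ?d = 0}"
    then have "cross2 (F - A) (P - A) = 0"
      using cross2_perp[OF sgn_diff_nonzero[OF assms] perp] by simp
    then show "P \<in> angle_bisector B A C"
      using sub \<open>F \<noteq> A\<close> by (auto simp: in_affine_hull_iff_cross2)
  qed
qed

text \<open>All points of the line have the same component along \<open>d\<close>, so by
  Cauchy-Schwarz none is nearer to \<open>P\<close> than the orthogonal projection
  \<open>?F\<close>.\<close>

lemma reflect_in_perp:
  assumes "d \<noteq> 0"
  shows "reflect_in {P. (P - A) \<bullet> d = 0} P = P - (2 * ((P - A) \<bullet> d) / (d \<bullet> d)) *\<^sub>R d"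
proof -
  let ?m = "{P. (P - A) \<bullet> d = 0}"
  let ?F = "P - (((P - A) \<bullet> d) / (d \<bullet> d)) *\<^sub>R d"
  have m: "?m = {P. d \<bullet> P = d \<bullet> A}"
    by (auto simp: inner_diff_left inner_diff_right inner_commute)
  have F: "?F \<in> ?m"
    using assms by (simp add: inner_diff_left)
  have "dist P ?F \<le> dist P z" if "z \<in> ?m" for z
  proof -
    have "(P - A) \<bullet> d = (P - z) \<bullet> d"
      using that by (simp add: inner_diff_left)
    then have "\<bar>(P - A) \<bullet> d\<bar> \<le> norm (P - z) * norm d"
      using Cauchy_Schwarz_ineq2 by metis
    then show ?thesis
      using assms by (simp add: dist_norm dot_square_norm power2_eq_square field_simps)
  qed
  then have "closest_point ?m P = ?F"
    using closest_point_unique[of ?m ?F P] F m convex_hyperplane closed_hyperplane by metis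
  then show ?thesis
    by (simp add: reflect_in_def scaleR_diff_right scaleR_2)
qed

text \<open>The reflection with normal \<open>b - c\<close> exchanges the unit vectors
  \<open>b\<close> and \<open>c\<close> and reverses orientation.\<close>

lemma cross2_reflect:
  assumes "b \<bullet> b = 1" "c \<bullet> c = 1" "b - c \<noteq> 0"
  shows "cross2 b (w - (2 * (w \<bullet> (b - c)) / ((b - c) \<bullet> (b - c))) *\<^sub>R (b - c)) = - cross2 c w"
proof -
  have "((b - c) \<bullet> (b - c)) * (cross2 b w + cross2 c w) = 2 * (w \<bullet> (b - c)) * cross2 b (b - c)"
    using assms(1,2) unfolding inner_real2 cross2_def by simp algebra
  moreover have "(b - c) \<bullet> (b - c) \<noteq> 0" using assms(3) by simp
  ultimately have "cross2 b w + cross2 c w = 2 * (w \<bullet> (b - c)) / ((b - c) \<bullet> (b - c)) * cross2 b (b - c)"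
    by (simp add: field_simps)
  then show ?thesis
    unfolding cross2_diff(2)[of _ w] cross2_scaleR by simp
qed

lemma sdist_reflect:
  assumes "\<not> collinear {A, B, C}"
  defines "\<rho> \<equiv> reflect_in (angle_bisector B A C)"
  shows "sdist A B (\<rho> P) = sdist C A P" "sdist C A (\<rho> P) = sdist A B P" "\<rho> (\<rho> P) = P"
proof -
  let ?b = "sgn (B - A)" and ?c = "sgn (C - A)"
  have d: "?b - ?c \<noteq> 0" by (rule sgn_diff_nonzero) fact
  have ne: "B \<noteq> A" "C \<noteq> A"
    using assms by (auto simp: collinear_iff_cross2)
  then have unit: "?b \<bullet> ?b = 1" "?c \<bullet> ?c = 1"
    by (simp_all add: dot_square_norm norm_sgn)
  have \<rho>: "\<rho> P - A = (P - A) - (2 * ((P - A) \<bullet> (?b - ?c)) / ((?b - ?c) \<bullet> (?b - ?c))) *\<^sub>R (?b - ?c)" for P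
    unfolding \<rho>_def angle_bisector_eq[OF assms(1)] reflect_in_perp[OF d] by simp
  \<comment> \<open>Negating the normal leaves the reflection unchanged; in this form
    \<open>cross2_reflect\<close> applies with the two unit vectors exchanged.\<close>
  have \<rho>': "\<rho> P - A = (P - A) - (2 * ((P - A) \<bullet> (?c - ?b)) / ((?c - ?b) \<bullet> (?c - ?b))) *\<^sub>R (?c - ?b)" for P
  proof -
    have "(2 * (w \<bullet> (- d)) / ((- d) \<bullet> (- d))) *\<^sub>R (- d) = (2 * (w \<bullet> d) / (d \<bullet> d)) *\<^sub>R d"
      for w d :: "real ^ 2" by simp
    from this[of "P - A" "?b - ?c"] show ?thesis
      unfolding \<rho> minus_diff_eq by (simp only:)
  qed
  show "sdist A B (\<rho> P) = sdist C A P"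
    unfolding sdist_other_end[of C A] unfolding sdist_def \<rho> using unit d by (rule cross2_reflect)
  have "cross2 ?c (\<rho> P - A) = - cross2 ?b (P - A)"
    unfolding \<rho>' using d by (intro cross2_reflect unit) simp
  then show "sdist C A (\<rho> P) = sdist A B P"
    unfolding sdist_other_end[of C A] unfolding sdist_def by simp
  have "(\<rho> P - A) \<bullet> (?b - ?c) = - ((P - A) \<bullet> (?b - ?c))"
    unfolding \<rho> inner_diff_left[of "P - A"] using d by simp
  then have "\<rho> (\<rho> P) - A = P - A"
    unfolding \<rho>[of "\<rho> P"] by (simp add: \<rho>)
  then show "\<rho> (\<rho> P) = P" by simp
qed

section \<open>Equations of isogonal lines\<close>

lemma is_line_through:
  assumes "is_line l" "A \<in> l"
  obtains Q where "Q \<noteq> A" "l = affine hull {A, Q}"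
proof -
  obtain R S where RS: "R \<noteq> S" and l: "l = affine hull {R, S}"
    using assms(1) unfolding is_line_def by auto
  \<comment> \<open>The direction of the line is attached at \<open>A\<close>, which works even if
    \<open>A\<close> is one of the two given points.\<close>
  define Q where "Q = A + (S - R)"
  have Q: "Q \<noteq> A" using RS by (simp add: Q_def)
  have A: "cross2 (S - R) (A - R) = 0"
    using assms(2) RS by (simp add: l in_affine_hull_iff_cross2)
  have "P \<in> l \<longleftrightarrow> P \<in> affine hull {A, Q}" for P
  proof -
    have "cross2 (S - R) (P - A) = cross2 (S - R) (P - R) - cross2 (S - R) (A - R)"
      by (simp flip: cross2_diff)
    then show ?thesis
      using A Q RS by (simp add: l in_affine_hull_iff_cross2) (simp add: Q_def)
  qed
  then show ?thesis using Q that by blast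
qed

lemma isogonal_lines:
  assumes nc: "\<not> collinear {A, B, C}" and l: "is_line l" "A \<in> l"
    and l': "l' = reflect_in (angle_bisector B A C) ` l"
  obtains u\<^sub>1 u\<^sub>2 where "u\<^sub>1 \<noteq> 0 \<or> u\<^sub>2 \<noteq> 0"
    and "\<And>P. P \<in> l \<longleftrightarrow> u\<^sub>1 * sdist C A P + u\<^sub>2 * sdist A B P = 0"
    and "\<And>P. P \<in> l' \<longleftrightarrow> u\<^sub>2 * sdist C A P + u\<^sub>1 * sdist A B P = 0"
proof -
  obtain Q where Q: "Q \<noteq> A" and lQ: "l = affine hull {A, Q}"
    using l by (rule is_line_through)
  \<comment> \<open>For fixed \<open>Q\<close> the determinant in \<open>sdist_det\<close> is linear
    in the distances of \<open>P\<close>; these are its coefficients.\<close>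
  let ?u1 = "- sdist A B Q" and ?u2 = "sdist C A Q"
  have ne: "B \<noteq> A" "C \<noteq> A" and cr: "cross2 (B - A) (C - A) \<noteq> 0"
    using nc by (auto simp: collinear_iff_cross2)
  \<comment> \<open>Otherwise the determinant vanishes for every \<open>P\<close>, and the whole
    plane lies on the line \<open>AQ\<close>.\<close>
  have nz: "?u1 \<noteq> 0 \<or> ?u2 \<noteq> 0"
  proof (rule ccontr)
    assume "\<not> ?thesis"
    then have 0: "sdist A B Q = 0" "sdist C A Q = 0" by auto
    have "P \<in> affine hull {A, Q}" for P
      using sdist_det[of Q A P B C] 0 cr Q by (simp add: in_affine_hull_iff_cross2)
    then have "{A, B, C} \<subseteq> affine hull {A, Q}" by blast
    then have "collinear {A, B, C}"
      by (rule collinear_subset[rotated]) (simp add: collinear_affine_hull_collinear)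
    with nc show False ..
  qed
  have mem: "P \<in> l \<longleftrightarrow> ?u1 * sdist C A P + ?u2 * sdist A B P = 0" for P
    using sdist_det[of Q A P B C] cr Q ne by (auto simp: lQ in_affine_hull_iff_cross2)
  have mem': "P \<in> l' \<longleftrightarrow> ?u2 * sdist C A P + ?u1 * sdist A B P = 0" for P
  proof -
    let ?\<rho> = "reflect_in (angle_bisector B A C)"
    \<comment> \<open>The reflection is an involution, so the image of \<open>l\<close> is also its
      preimage.\<close>
    have "P \<in> l' \<longleftrightarrow> ?\<rho> P \<in> l"
      by (auto simp: l' sdist_reflect(3)[OF nc] intro!: image_eqI[of _ _ "?\<rho> P"])
    then show ?thesis
      by (simp only: mem sdist_reflect[OF nc] add.commute)
  qed
  show ?thesis
  proof (rule that[of ?u1 ?u2])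
    show "P \<in> l \<longleftrightarrow> ?u1 * sdist C A P + ?u2 * sdist A B P = 0" for P by (rule mem)
    show "P \<in> l' \<longleftrightarrow> ?u2 * sdist C A P + ?u1 * sdist A B P = 0" for P by (rule mem')
  qed (rule nz)
qed

text \<open>If both coefficients vanished, then \<open>l\<^sub>B\<close> and \<open>l'\<^sub>C\<close> would be the lines \<open>AB\<close> and \<open>AC\<close>, or both
  would be \<open>BC\<close>.\<close>

lemma cevian_coefficients:
  assumes nc: "\<not> collinear {A, B, C}"
    and nz: "v\<^sub>1 \<noteq> 0 \<or> v\<^sub>2 \<noteq> 0" "w\<^sub>1 \<noteq> 0 \<or> w\<^sub>2 \<noteq> 0"
    and m: "\<And>P. P \<in> m \<longleftrightarrow> v\<^sub>1 * sdist A B P + v\<^sub>2 * sdist B C P = 0"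
    and n: "\<And>P. P \<in> n \<longleftrightarrow> w\<^sub>2 * sdist B C P + w\<^sub>1 * sdist C A P = 0"
    and X: "m \<inter> n = {X}" "X \<noteq> A"
  shows "v\<^sub>2 * w\<^sub>1 * sdist C A X + (- (v\<^sub>1 * w\<^sub>2)) * sdist A B X = 0"
    and "v\<^sub>2 * w\<^sub>1 \<noteq> 0 \<or> - (v\<^sub>1 * w\<^sub>2) \<noteq> 0"
proof -
  have Xm: "v\<^sub>1 * sdist A B X + v\<^sub>2 * sdist B C X = 0"
    and Xn: "w\<^sub>2 * sdist B C X + w\<^sub>1 * sdist C A X = 0"
    using X(1) m n by auto
  then show "v\<^sub>2 * w\<^sub>1 * sdist C A X + (- (v\<^sub>1 * w\<^sub>2)) * sdist A B X = 0"
    by algebra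
  show "v\<^sub>2 * w\<^sub>1 \<noteq> 0 \<or> - (v\<^sub>1 * w\<^sub>2) \<noteq> 0"
  proof (rule ccontr)
    assume "\<not> ?thesis"
    then consider "v\<^sub>1 = 0" "w\<^sub>1 = 0" | "v\<^sub>2 = 0" "w\<^sub>2 = 0" "v\<^sub>1 \<noteq> 0" "w\<^sub>1 \<noteq> 0"
      using nz by auto
    then show False
    proof cases
      case 1
      then have "B \<in> m \<inter> n" "C \<in> m \<inter> n" by (simp_all add: m n)
      then have "B = C" using X(1) by auto
      with nc show False by simp
    next
      case 2
      then have "A \<in> m \<inter> n" by (simp add: m n)
      then show False using X by auto
    qed
  qed
qed

section \<open>Points with given trilinear coordinates, and parallel lines\<close>

text \<open>Trilinear coordinates become barycentric weights when multiplied by the side lengths. A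
  nonzero sum \<open>?s\<close> can be normalised to give a point; a zero sum gives a direction,
  that is, a point at infinity.\<close>

lemma trilinear_point:
  assumes nc: "\<not> collinear {A, B, C}" and nz: "p \<noteq> 0 \<or> q \<noteq> 0 \<or> r \<noteq> 0"
  obtains k P where "k \<noteq> 0" "sdist B C P = k * p" "sdist C A P = k * q" "sdist A B P = k * r"
  | k d where "k \<noteq> 0" "d \<noteq> 0" "cross2 (sgn (C - B)) d = k * p" "cross2 (sgn (A - C)) d = k * q"
      "cross2 (sgn (B - A)) d = k * r"
proof -
  let ?a = "norm (C - B)" and ?b = "norm (A - C)" and ?c = "norm (B - A)"
  let ?D = "cross2 (B - A) (C - A)"
  let ?s = "?a * p + ?b * q + ?c * r"
  have D: "?D \<noteq> 0" using nc by (simp add: collinear_iff_cross2)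
  have ne: "?a \<noteq> 0" "?b \<noteq> 0" "?c \<noteq> 0"
    using nc by (auto simp: insert_commute)
  \<comment> \<open>Each side times its signed altitude is twice the signed area.\<close>
  have x: "?a * sdist B C A = ?D" "?b * sdist C A B = ?D" "?c * sdist A B C = ?D"
    by (simp_all add: norm_sdist cross2_def algebra_simps)
  show ?thesis
  proof (cases "?s = 0")
    case False
    define P where "P = (?a * p / ?s) *\<^sub>R A + (?b * q / ?s) *\<^sub>R B + (?c * r / ?s) *\<^sub>R C"
    have "?a * p / ?s + ?b * q / ?s + ?c * r / ?s = 1"
      using False by (simp flip: add_divide_distrib)
    then have P: "sdist U V P = ?a * p / ?s * sdist U V A + ?b * q / ?s * sdist U V B + ?c * r / ?s * sdist U V C"
      for U V unfolding P_def by (rule sdist_combination)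
    show ?thesis
    proof (rule that(1)[of "?D / ?s" P])
      show "?D / ?s \<noteq> 0" using D False by simp
      show "sdist B C P = ?D / ?s * p" unfolding P x(1)[symmetric] by simp
      show "sdist C A P = ?D / ?s * q" unfolding P x(2)[symmetric] by simp
      show "sdist A B P = ?D / ?s * r" unfolding P x(3)[symmetric] by simp
    qed
  next
    case True
    define d where "d = (?a * p) *\<^sub>R A + (?b * q) *\<^sub>R B + (?c * r) *\<^sub>R C"
    have d: "cross2 (sgn (V - U)) d = ?a * p * sdist U V A + ?b * q * sdist U V B + ?c * r * sdist U V C"
      for U V :: "real ^ 2"
    proof -
      \<comment> \<open>Weights with sum zero define a vector that does not depend on the origin, so
        \<open>U\<close> may serve as origin.\<close>
      have "d = (?a * p) *\<^sub>R (A - U) + (?b * q) *\<^sub>R (B - U) + (?c * r) *\<^sub>R (C - U) + ?s *\<^sub>R U"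
        by (simp add: d_def algebra_simps)
      then show ?thesis
        unfolding True by (simp add: sdist_def cross2_linear)
    qed
    have *: "cross2 (sgn (C - B)) d = ?D * p" "cross2 (sgn (A - C)) d = ?D * q"
      "cross2 (sgn (B - A)) d = ?D * r"
      unfolding d using x by simp_all
    have "d \<noteq> 0" using * nz D by auto
    then show ?thesis using that(2)[of ?D d] D * by blast
  qed
qed

text \<open>Each line consists of its base point plus the multiples of \<open>d\<close>, so
  translation by \<open>B - A\<close> carries one to the other. Coincident lines also count as
  parallel.\<close>

lemma affine_parallel_direction:
  fixes A B X Y d :: "real ^ 2"
  assumes "d \<noteq> 0" "X \<noteq> A" "Y \<noteq> B" "A + d \<in> affine hull {A, X}" "B + d \<in> affine hull {B, Y}"
  shows "affine_parallel (affine hull {A, X}) (affine hull {B, Y})"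
proof -
  have line: "affine hull {U, V} = (\<lambda>t. U + t *\<^sub>R d) ` UNIV"
    if "V \<noteq> U" "U + d \<in> affine hull {U, V}" for U V :: "real ^ 2"
  proof -
    have VUd: "cross2 (V - U) d = 0"
      using that by (simp add: in_affine_hull_iff_cross2)
    then have "cross2 d (V - U) = 0" using cross2_commute[of d] by simp
    then obtain s where s: "V - U = s *\<^sub>R d" using assms(1) by (rule cross2_eq_0E)
    then have "s \<noteq> 0" using that(1) by auto
    show ?thesis
    proof (intro equalityI subsetI)
      fix Q assume "Q \<in> affine hull {U, V}"
      then have "cross2 d (Q - U) = 0"
        using that(1) \<open>s \<noteq> 0\<close> s by (simp add: in_affine_hull_iff_cross2 cross2_scaleR)
      then obtain t where "Q - U = t *\<^sub>R d" using assms(1) by (rule cross2_eq_0E)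
      then have "Q = U + t *\<^sub>R d" by (simp add: algebra_simps)
      then show "Q \<in> (\<lambda>t. U + t *\<^sub>R d) ` UNIV" by blast
    qed (use that(1) VUd in \<open>auto simp: in_affine_hull_iff_cross2 cross2_scaleR\<close>)
  qed
  have "affine hull {B, Y} = (+) (B - A) ` (affine hull {A, X})"
    using line[OF assms(2,4)] line[OF assms(3,5)] by (simp add: image_image algebra_simps)
  then show ?thesis unfolding affine_parallel_def by blast
qed

section \<open>Concurrency or parallelism of the three cevians\<close>

theorem theorem1:
  fixes A B C X Y Z :: "real ^ 2"
    and l\<^sub>A l\<^sub>B l\<^sub>C l'\<^sub>A l'\<^sub>B l'\<^sub>C :: "(real ^ 2) set"
  assumes triangle: "\<not> collinear {A, B, C}"
    and lines: "is_line l\<^sub>A" "is_line l\<^sub>B" "is_line l\<^sub>C"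
    and through: "A \<in> l\<^sub>A" "B \<in> l\<^sub>B" "C \<in> l\<^sub>C"
    and symmetric:
      "l'\<^sub>A = reflect_in (angle_bisector B A C) ` l\<^sub>A"
      "l'\<^sub>B = reflect_in (angle_bisector C B A) ` l\<^sub>B"
      "l'\<^sub>C = reflect_in (angle_bisector A C B) ` l\<^sub>C"
    and intersections: "l\<^sub>B \<inter> l'\<^sub>C = {X}" "l\<^sub>C \<inter> l'\<^sub>A = {Y}" "l\<^sub>A \<inter> l'\<^sub>B = {Z}"
    and joins: "X \<noteq> A" "Y \<noteq> B" "Z \<noteq> C"
  shows "(\<exists>P. P \<in> affine hull {A, X} \<and> P \<in> affine hull {B, Y} \<and> P \<in> affine hull {C, Z}) \<or>
    (affine_parallel (affine hull {A, X}) (affine hull {B, Y}) \<and>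
     affine_parallel (affine hull {B, Y}) (affine hull {C, Z}))"
proof -
  have tB: "\<not> collinear {B, C, A}" and tC: "\<not> collinear {C, A, B}"
    using triangle by (simp_all add: insert_commute)
  obtain u\<^sub>1 u\<^sub>2 where u: "u\<^sub>1 \<noteq> 0 \<or> u\<^sub>2 \<noteq> 0"
    "\<And>P. P \<in> l\<^sub>A \<longleftrightarrow> u\<^sub>1 * sdist C A P + u\<^sub>2 * sdist A B P = 0"
    "\<And>P. P \<in> l'\<^sub>A \<longleftrightarrow> u\<^sub>2 * sdist C A P + u\<^sub>1 * sdist A B P = 0"
    using triangle lines(1) through(1) symmetric(1) by (rule isogonal_lines) (use that in blast)
  obtain v\<^sub>1 v\<^sub>2 where v: "v\<^sub>1 \<noteq> 0 \<or> v\<^sub>2 \<noteq> 0"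
    "\<And>P. P \<in> l\<^sub>B \<longleftrightarrow> v\<^sub>1 * sdist A B P + v\<^sub>2 * sdist B C P = 0"
    "\<And>P. P \<in> l'\<^sub>B \<longleftrightarrow> v\<^sub>2 * sdist A B P + v\<^sub>1 * sdist B C P = 0"
    using tB lines(2) through(2) symmetric(2) by (rule isogonal_lines) (use that in blast)
  obtain w\<^sub>1 w\<^sub>2 where w: "w\<^sub>1 \<noteq> 0 \<or> w\<^sub>2 \<noteq> 0"
    "\<And>P. P \<in> l\<^sub>C \<longleftrightarrow> w\<^sub>1 * sdist B C P + w\<^sub>2 * sdist C A P = 0"
    "\<And>P. P \<in> l'\<^sub>C \<longleftrightarrow> w\<^sub>2 * sdist B C P + w\<^sub>1 * sdist C A P = 0"
    using tC lines(3) through(3) symmetric(3) by (rule isogonal_lines) (use that in blast)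
  note cX = cevian_coefficients[OF triangle v(1) w(1) v(2) w(3) intersections(1) joins(1)]
  note cY = cevian_coefficients[OF tB w(1) u(1) w(2) u(3) intersections(2) joins(2)]
  note cZ = cevian_coefficients[OF tC u(1) v(1) u(2) v(3) intersections(3) joins(3)]
  note onX = sdist_line[OF triangle joins(1) cX(2) cX(1)]
  note onY = sdist_line[OF tB joins(2) cY(2) cY(1)]
  note onZ = sdist_line[OF tC joins(3) cZ(2) cZ(1)]
  \<comment> \<open>If \<open>u\<^sub>2\<close> is zero, the conditions at \<open>B\<close> and
    \<open>C\<close> make the first product nonzero; otherwise the condition at \<open>A\<close>
    makes one of the other two nonzero.\<close>
  have "u\<^sub>1 * v\<^sub>2 * w\<^sub>2 \<noteq> 0 \<or> u\<^sub>2 * v\<^sub>1 * w\<^sub>2 \<noteq> 0 \<or> u\<^sub>2 * v\<^sub>2 * w\<^sub>1 \<noteq> 0"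
    using cX(2) cY(2) cZ(2) by auto
  with triangle show ?thesis
  proof (cases rule: trilinear_point)
    case (1 k P)
    have "P \<in> affine hull {A, X}" by (rule onX) (simp add: 1 algebra_simps)
    moreover have "P \<in> affine hull {B, Y}" by (rule onY) (simp add: 1 algebra_simps)
    moreover have "P \<in> affine hull {C, Z}" by (rule onZ) (simp add: 1 algebra_simps)
    ultimately show ?thesis by blast
  next
    case (2 k d)
    \<comment> \<open>The distances to both sides at \<open>A\<close> vanish at \<open>A\<close>, so
      those of \<open>A + d\<close> come from \<open>d\<close> alone and satisfy the equation of
      \<open>AX\<close>.\<close>
    have "A + d \<in> affine hull {A, X}" by (rule onX) (simp add: sdist_translate 2 algebra_simps)
    moreover have "B + d \<in> affine hull {B, Y}" by (rule onY) (simp add: sdist_translate 2 algebra_simps)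
    moreover have "C + d \<in> affine hull {C, Z}" by (rule onZ) (simp add: sdist_translate 2 algebra_simps)
    ultimately show ?thesis
      using affine_parallel_direction[OF \<open>d \<noteq> 0\<close>] joins by blast
  qed
qed

end
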